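(* Fix $f\in(0,1)$, put $L:=\frac{1-f}{2}\log\left(\frac{1}{1-f}\right)$, and for $T>0$ define $$\mathcal{L}_{fT}:=\frac{\sqrt{f(1-f)}}{4\left(3f+1+2fLT+\sqrt{2}(1-f)\right)}\exp\left\{-\frac{f(LT+1)(LT+2)+\left(\frac{1+\sqrt{2}}{\sqrt{2}}\right)(1-f)}{f(1-f)T}\right\}.$$ Then the function $T\mapsto\mathcal{L}_{fT}$ on $(0,\infty)$ has exactly one maximum: it attains its maximum over $(0,\infty)$, and there is exactly one point of $(0,\infty)$ at which it has a local maximum.
   Context: Here $\log$ is the natural logarithm. No other notation is needed. *)

theory Defs
  imports Complex_Main
begin

definition L_const :: "real \<Rightarrow> real" where
  "L_const f = (1 - f) / 2 * ln (1 / (1 - f))"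

definition L_fun :: "real \<Rightarrow> real \<Rightarrow> real" where
  "L_fun f T =
     sqrt (f * (1 - f)) / (4 * (3 * f + 1 + 2 * f * L_const f * T + sqrt 2 * (1 - f))) *
     exp (- ((f * (L_const f * T + 1) * (L_const f * T + 2)
               + ((1 + sqrt 2) / sqrt 2) * (1 - f))
             / (f * (1 - f) * T)))"

(* Non-strict local maximum of g relative to S. *)
definition local_max_on :: "('a::topological_space \<Rightarrow> 'b::order) \<Rightarrow> 'a set \<Rightarrow> 'a \<Rightarrow> bool" where
  "local_max_on g S x \<longleftrightarrow> x \<in> S \<and> (\<forall>\<^sub>F y in at x within S. g y \<le> g x)"

end

(* Up to a positive constant the function is exp (- (E / T + D + F T)) / (A + B T) with positive
   A, B, E, F. The sign of its derivative at T > 0 is that of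
   E - F T^2 - B T^2 / (A + B T), which is strictly decreasing, positive at 0 and negative at
   sqrt (E / F), so the function increases strictly up to a unique point and decreases
   strictly after it. *)

theory Submission
  imports Defs
begin

text \<open>Every x other than \<open>c\<close> has points arbitrarily close to it, on the side
  facing \<open>c\<close>, where \<open>g\<close> is strictly larger. This excludes even a
  non-strict local maximum at x.\<close>

lemma local_max_on_unimodal_unique:
  fixes g :: "real \<Rightarrow> real"
  assumes c: "a < c"
    and inc: "\<And>x y. a < x \<Longrightarrow> x < y \<Longrightarrow> y \<le> c \<Longrightarrow> g x < g y"
    and dec: "\<And>x y. c \<le> x \<Longrightarrow> x < y \<Longrightarrow> g y < g x"
  shows "is_arg_max g (\<lambda>x. x \<in> {a<..}) c" and "\<exists>!x. local_max_on g {a<..} x"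
proof -
  have le: "g x \<le> g c" if "a < x" for x
    using inc[of x c] dec[of c x] that by (cases x c rule: linorder_cases) auto
  show "is_arg_max g (\<lambda>x. x \<in> {a<..}) c"
    using c by (auto simp: is_arg_max_def dest: le)
  show "\<exists>!x. local_max_on g {a<..} x"
  proof (rule ex1I)
    show "local_max_on g {a<..} c"
      using c le by (auto simp: local_max_on_def eventually_at_filter)
  next
    fix x assume "local_max_on g {a<..} x"
    then have x: "a < x" and "\<forall>\<^sub>F y in at x within {a<..}. g y \<le> g x"
      by (auto simp: local_max_on_def)
    then obtain d where d: "d > 0" "\<And>y. a < y \<Longrightarrow> y \<noteq> x \<Longrightarrow> dist y x < d \<Longrightarrow> g y \<le> g x"
      unfolding eventually_at by auto
    show "x = c"
    proof (cases x c rule: linorder_cases)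
      case less
      \<comment> \<open>A move from \<open>x\<close> towards \<open>c\<close> of length at most d/2,
        cut off at \<open>c\<close> so that both points lie where \<open>inc\<close> applies. The
        case \<open>greater\<close> mirrors this.\<close>
      define y where "y = min c (x + d / 2)"
      have "x < y" "y \<le> c" "dist y x < d"
        using less d(1) by (auto simp: y_def dist_real_def min_def)
      then show ?thesis
        using inc[of x y] d(2)[of y] x by force
    next
      case greater
      define y where "y = max c (x - d / 2)"
      have "y < x" "c \<le> y" "dist y x < d"
        using greater d(1) by (auto simp: y_def dist_real_def max_def)
      then show ?thesis
        using dec[of y x] d(2)[of y] c by force
    qed
  qed
qed

lemma unimodal_rational_exp:
  fixes A B C D E F :: real
  assumes pos: "A > 0" "B > 0" "C > 0" "E > 0" "F > 0"
    and g: "\<And>T. T > 0 \<Longrightarrow> g T = C / (A + B * T) * exp (- (E / T + D + F * T))"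
  obtains c where "0 < c"
    and "\<And>x y. 0 < x \<Longrightarrow> x < y \<Longrightarrow> y \<le> c \<Longrightarrow> g x < g y"
    and "\<And>x y. c \<le> x \<Longrightarrow> x < y \<Longrightarrow> g y < g x"
proof -
  \<comment> \<open>For T > 0, \<open>h\<close> is the logarithm of \<open>g\<close> up to an
    additive constant. The factor T^2 in k = T^2 h' removes the pole at 0, so \<open>k\<close> is
    continuous on the closed interval from 0 and \<open>k 0\<close> = E is its value there.\<close>
  define h where "h T = - (E / T + F * T) - ln (A + B * T)" for T
  define k where "k T = E - F * T\<^sup>2 - B * (T\<^sup>2 / (A + B * T))" for T
  have den: "A + B * T > 0" if "T \<ge> 0" for T
    using pos that by (simp add: add_pos_nonneg)
  have g_h: "g T = C * exp (- D) * exp (h T)" if "T > 0" for T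
  proof -
    have "exp (h T) = exp (- (E / T + F * T)) / (A + B * T)"
      using den[of T] that by (simp only: h_def exp_diff exp_ln less_imp_le)
    moreover have "exp (- (E / T + D + F * T)) = exp (- D) * exp (- (E / T + F * T))"
      by (simp flip: exp_add)
    ultimately show ?thesis
      using that by (simp add: g)
  qed
  have g_less: "g x < g y" if "0 < x" "0 < y" "h x < h y" for x y
    using that pos by (simp add: g_h)
  have deriv: "(h has_real_derivative k T / T\<^sup>2) (at T)" if "T > 0" for T
  proof -
    have "k T / T\<^sup>2 = E / T\<^sup>2 - F - B / (A + B * T)"
      using that by (simp add: k_def diff_divide_distrib)
    then show ?thesis
      unfolding h_def using that den[of T]
      by (auto intro!: derivative_eq_intros simp: power2_eq_square)
  qed
  have k_dec: "k y < k x" if "0 \<le> x" "x < y" for x y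
  proof -
    have sq: "x\<^sup>2 < y\<^sup>2"
      using that by (simp add: power_strict_mono)
    \<comment> \<open>This is the numerator of the difference of T^2 / (A + B T) at \<open>y\<close>
      and \<open>x\<close>. The term with \<open>A\<close> keeps it strictly positive even for x =
      0.\<close>
    have "y\<^sup>2 * (A + B * x) - x\<^sup>2 * (A + B * y) = A * (y\<^sup>2 - x\<^sup>2) + B * x * y * (y - x)"
      by (simp add: algebra_simps power2_eq_square)
    also have "\<dots> > 0"
      using that sq pos by (intro add_pos_nonneg) auto
    finally have "x\<^sup>2 / (A + B * x) < y\<^sup>2 / (A + B * y)"
      using den[of x] den[of y] that by (simp add: divide_simps mult.commute)
    then have "B * (x\<^sup>2 / (A + B * x)) < B * (y\<^sup>2 / (A + B * y))" "F * x\<^sup>2 < F * y\<^sup>2"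
      using pos sq by (simp_all only: mult_strict_left_mono)
    then show ?thesis
      by (simp add: k_def)
  qed
  \<comment> \<open>At \<open>u\<close> the part E - F T^2 vanishes and only the negative fraction
    is left, so \<open>k\<close> changes sign between 0 and \<open>u\<close>.\<close>
  define u where "u = sqrt (E / F)"
  have u: "u > 0" "F * u\<^sup>2 = E"
    using pos by (auto simp: u_def)
  have "k 0 > 0"
    using pos by (simp add: k_def)
  have "k u < 0"
    using u pos den[of u] by (simp add: k_def)
  have "continuous_on {0..u} k"
    unfolding k_def using den by (intro continuous_intros) force
  then obtain c where c: "0 \<le> c" "k c = 0"
    using IVT2'[of k u 0 0] \<open>k 0 > 0\<close> \<open>k u < 0\<close> u(1) by fastforce
  have "c \<noteq> 0"
    using c \<open>k 0 > 0\<close> by auto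
  then have c0: "c > 0"
    using c by simp
  have inc: "h x < h y" if "0 < x" "x < y" "y \<le> c" for x y
  \<comment> \<open>The derivative vanishes at \<open>c\<close>, which \<open>y\<close> may equal.
    Hence the criterion that asks for a positive derivative only in the interior, plus continuity on
    the closed interval.\<close>
  proof (rule DERIV_pos_imp_increasing_open[OF \<open>x < y\<close>])
    fix z assume "x < z" "z < y"
    then show "\<exists>d. (h has_real_derivative d) (at z) \<and> d > 0"
      using that deriv[of z] k_dec[of z c] c by (intro exI[of _ "k z / z\<^sup>2"]) auto
  next
    show "continuous_on {x..y} h"
      using that deriv by (intro DERIV_continuous_on[of _ _ "\<lambda>z. k z / z\<^sup>2"])
        (auto intro: has_field_derivative_at_within)
  qed
  have dec: "h y < h x" if "c \<le> x" "x < y" for x y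
  proof (rule DERIV_neg_imp_decreasing_open[OF \<open>x < y\<close>])
    fix z assume "x < z" "z < y"
    then show "\<exists>d. (h has_real_derivative d) (at z) \<and> d < 0"
      using that deriv[of z] k_dec[of c z] c c0
      by (intro exI[of _ "k z / z\<^sup>2"]) (auto simp: divide_neg_pos)
  next
    show "continuous_on {x..y} h"
      using that c0 deriv by (intro DERIV_continuous_on[of _ _ "\<lambda>z. k z / z\<^sup>2"])
        (auto intro: has_field_derivative_at_within)
  qed
  show thesis
    using that[of c] c0 inc dec g_less by force
qed

theorem mainTheorem2:
  fixes f :: real
  assumes "0 < f" and "f < 1"
  shows "(\<exists>T. is_arg_max (L_fun f) (\<lambda>T. T \<in> {0<..}) T) \<and>
         (\<exists>!T. local_max_on (L_fun f) {0<..} T)"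
proof -
  define L where "L = L_const f"
  define q where "q = (1 + sqrt 2) / sqrt 2"
  define A where "A = 3 * f + 1 + sqrt 2 * (1 - f)"
  define E where "E = (2 * f + q * (1 - f)) / (f * (1 - f))"
  \<comment> \<open>Since 0 < f < 1, the logarithm of 1 / (1 - f) is positive. This makes the
    coefficients of T in the denominator and in the exponent positive.\<close>
  have "L > 0"
    using assms by (simp add: L_def L_const_def)
  have "q > 0"
    by (simp add: q_def add_pos_pos)
  have pos: "A > 0" "2 * f * L > 0" "sqrt (f * (1 - f)) / 4 > 0" "E > 0" "L\<^sup>2 / (1 - f) > 0"
    using assms \<open>L > 0\<close> \<open>q > 0\<close> by (auto simp: A_def E_def intro!: add_pos_pos divide_pos_pos)
  have L_fun_eq: "L_fun f T = sqrt (f * (1 - f)) / 4 / (A + 2 * f * L * T) *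
      exp (- (E / T + 3 * L / (1 - f) + L\<^sup>2 / (1 - f) * T))" if "T > 0" for T
  proof -
    \<comment> \<open>Expand (L T + 1)(L T + 2) = L^2 T^2 + 3 L T + 2 and divide by T: the three
      powers of T give the terms with \<open>F\<close>, \<open>D\<close> and \<open>E\<close> of the
      general lemma.\<close>
    have "(f * (L * T + 1) * (L * T + 2) + q * (1 - f)) / (f * (1 - f) * T) =
        E / T + 3 * L / (1 - f) + L\<^sup>2 / (1 - f) * T"
      using assms that by (simp add: E_def divide_simps) (simp add: algebra_simps power2_eq_square)
    moreover have "3 * f + 1 + 2 * f * L * T + sqrt 2 * (1 - f) = A + 2 * f * L * T"
      by (simp add: A_def)
    ultimately show ?thesis
      by (simp add: L_fun_def flip: L_def q_def)
  qed
  obtain c where "0 < c"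
    and "\<And>x y. 0 < x \<Longrightarrow> x < y \<Longrightarrow> y \<le> c \<Longrightarrow> L_fun f x < L_fun f y"
    and "\<And>x y. c \<le> x \<Longrightarrow> x < y \<Longrightarrow> L_fun f y < L_fun f x"
    using unimodal_rational_exp[OF pos L_fun_eq] by blast
  from local_max_on_unimodal_unique[of 0 c "L_fun f", OF this] show ?thesis
    by blast
qed

end
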